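(* 1) Consider an $SE(3)\times SE(3)$-transformer layer (defined in the context), and denote by $\varphi_K$ and $\varphi_V$ the radial functions used in the key kernels $\mathcal{W}_K$ and in the value kernels $\mathcal{W}_V$ respectively. Let all $\varphi_K$ be degree-$0$ functions, and let the input field $f_{in}$ be degree-$0$ $\mathbb{R}_+$-equivariant. If all $\varphi_V$ are degree-$1$ functions and the self-interaction weights are $W=0$, then the output field $f_{out}$ is degree-$1$ $\mathbb{R}_+$-equivariant. If all $\varphi_V$ are degree-$0$ functions, then the output field $f_{out}$ is degree-$0$ $\mathbb{R}_+$-equivariant. 2) For an Elu layer (defined in the context), if the input field is degree-$p$ $\mathbb{R}_+$-equivariant, then the output field is also degree-$p$ $\mathbb{R}_+$-equivariant. Here, for a layer $\mathcal{L}$, saying that a degree-$p$ $\mathbb{R}_+$-equivariant input field yields a degree-$q$ $\mathbb{R}_+$-equivariant output field means that for every input field $f$ and every $c\in\mathbb{R}_+$, applying $\mathcal{L}$ to the field $z\mapsto c^pf(c^{-1}z)$ gives the field $z\mapsto c^q(\mathcal{L}(f))(c^{-1}z)$.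
   Context: **Degree-$p$ functions.** $\varphi:\mathbb{R}\times\mathbb{R}\to\mathbb{R}$ is a degree-$p$ function if $\varphi(cx,cy)=c^p\varphi(x,y)$ for all $x,y$ and all $c\in\mathbb{R}_+$ (positive reals). **Conventions.** $\|\cdot\|$ is the Euclidean norm, $\oplus$ is concatenation, $\otimes$ is the Kronecker product, $\mathrm{vec}$ stacks the columns of a matrix. **Representations.** $\rho_p$ ($p\in\mathbb{N}$) is the real orthogonal irreducible representation of $SO(3)$ of dimension $2p+1$. $Y_J$ is the vector of real spherical harmonics of degree $J$, so $Y_J(rx)=\rho_J(r)Y_J(x)$ for $\|x\|=1$; by convention $Y_J(x/\|x\|)$ for $x=0$ means $0$ if $J>0$ and the constant $Y_0$ if $J=0$. For $|i-o|\le J\le i+o$, $C_J^{i,o}\in\mathbb{R}^{(2i+1)(2o+1)\times(2J+1)}$ is a fixed real Clebsch–Gordan matrix: $(\rho_i(r)\otimes\rho_o(r))C_J^{i,o}=C_J^{i,o}\rho_J(r)$, with entries $\langle i,m,o,m'|J,m''\rangle$. For $\boldsymbol o=(o_1,o_2)$, $\boldsymbol i=(i_1,i_2)\in\mathbb{N}^2$, the second-order Clebsch–Gordan matrix $\mathcal{Q}^{\boldsymbol o,\boldsymbol i}_{J_1,J_2}$ has rows indexed by $(m_1,m_2,m_3,m_4)$, columns by $(m_5,m_6)$, and entries $\langle i_1,m_1,o_1,m_3|J_1,m_5\rangle\langle i_2,m_2,o_2,m_4|J_2,m_6\rangle$. **6-D tensor fields.** A field $f$ is a finite indexed family of points $z_u\in\mathbb{R}^6$,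 $u=1,\dots,L$, with features $f^{\boldsymbol i,b}(z_u)\in\mathbb{R}^{(2i_1+1)(2i_2+1)}$, $\boldsymbol i$ ranging over a finite set of degrees in $\mathbb{N}^2$ and $b$ over channels. $F^{\boldsymbol i}(z_u)$ is the matrix whose rows are the channels $f^{\boldsymbol i,b}(z_u)$. Write $z=z^1\oplus z^2$ with $z^1,z^2\in\mathbb{R}^3$. **Scaling.** A field is degree-$p$ $\mathbb{R}_+$-equivariant ($p\in\mathbb{N}$) if $c\in\mathbb{R}_+$ acts on it by $(c(f))(z)=c^pf(c^{-1}z)$; i.e. $c(f)$ is supported on the points $cz_u$ with features $c^pf_u$. **$SE(3)\times SE(3)$-transformer layer.** It keeps the points $z_u$ and sends $f_{in}$ to $f_{out}$, where for each output degree $\boldsymbol o$ and output channel $a$ $$f_{out}^{\boldsymbol o,a}(z_u)=W^{\boldsymbol o,a}F_{in}^{\boldsymbol o}(z_u)+\sum_{v\in KNN(u)\setminus\{u\}}\alpha_{uv}\sum_{\boldsymbol i,b}\mathcal{W}_V^{\boldsymbol o,\boldsymbol i,a,b}(z_v-z_u)f_{in}^{\boldsymbol i,b}(z_v),$$ the first term being absent if $f_{in}$ has no degree-$\boldsymbol o$ feature. $W^{\boldsymbol o,a}$ is a row vector of (self-interaction) weights. $KNN(u)$ is the set of indices of the $k$ nearest points to $z_u$ in Euclidean distance of $\mathbb{R}^6$, ties broken by index. The attention is $\alpha_{uv}=\exp(\mathbf{Q}_u^\top\mathbf{K}_{uv})/\sum_{v'\in KNN(u)\setminus\{u\}}\exp(\mathbf{Q}_u^\top\mathbf{K}_{uv'})$,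 with query $\mathbf{Q}_u=\bigoplus_{\boldsymbol o}W_Q^{\boldsymbol o}F_{in}^{\boldsymbol o}(z_u)$ and key $\mathbf{K}_{uv}=\bigoplus_{\boldsymbol o}\sum_{\boldsymbol i,b}\mathcal{W}_K^{\boldsymbol o,\boldsymbol i,b}(z_v-z_u)f_{in}^{\boldsymbol i,b}(z_v)$, $\boldsymbol o$ ranging over the input degrees and $W_Q^{\boldsymbol o}$ a row vector of weights. Every kernel ($\mathcal{W}_K$ or $\mathcal{W}_V$, each channel index) is a $(2o_1+1)(2o_2+1)\times(2i_1+1)(2i_2+1)$ matrix of the form $$\mathrm{vec}(\mathcal{W}^{\boldsymbol o,\boldsymbol i}(z))=\sum_{J_1=|o_1-i_1|}^{o_1+i_1}\ \sum_{J_2=|o_2-i_2|}^{o_2+i_2}\varphi^{\boldsymbol o,\boldsymbol i}_{J_1,J_2}(\|z^1\|,\|z^2\|)\,\mathcal{Q}^{\boldsymbol o,\boldsymbol i}_{J_1,J_2}\Bigl(Y_{J_1}\bigl(\tfrac{z^1}{\|z^1\|}\bigr)\otimes Y_{J_2}\bigl(\tfrac{z^2}{\|z^2\|}\bigr)\Bigr),$$ with radial functions $\varphi:\mathbb{R}\times\mathbb{R}\to\mathbb{R}$ (one for each kernel, channel index and $J_1,J_2$). **Elu layer.** Pointwise, on each degree $\boldsymbol i$ with $c$ channels: $F_\mu=W_\mu^{\boldsymbol i}F^{\boldsymbol i}$, $F_\nu=W_\nu^{\boldsymbol i}F^{\boldsymbol i}$ with $W_\mu^{\boldsymbol i},W_\nu^{\boldsymbol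 i}\in\mathbb{R}^{c\times c}$; each output channel equals $F_\mu$ if $\langle F_\mu,F_\nu\rangle\ge 0$ and $F_\mu-\langle F_\mu,\frac{F_\nu}{\|F_\nu\|}\rangle\frac{F_\nu}{\|F_\nu\|}$ otherwise (inner product and norm taken channel by channel). *)

theory Defs
  imports "HOL-Analysis.Analysis" "Jordan_Normal_Form.Matrix"
begin

text \<open>
  Vectors and matrices whose size depends on a natural number are those of
  \<^theory>\<open>Jordan_Normal_Form.Matrix\<close>; the type \<open>real ^ 3\<close> is used only for points and
  rotations of three-dimensional space.  All vector and matrix indices start at 0, so the
  order index \<open>m \<in> {-J..J}\<close> of a degree-\<open>J\<close> object appears as \<open>m + J \<in> {0..2J}\<close>.
  The letter \<open>l\<close> stands for an output degree, \<open>i\<close> for an input degree.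
\<close>

unbundle no vec_syntax

definition homogeneous2 :: "nat \<Rightarrow> (real \<Rightarrow> real \<Rightarrow> real) \<Rightarrow> bool" where
  "homogeneous2 p \<phi> \<longleftrightarrow> (\<forall>c>0. \<forall>x y. \<phi> (c * x) (c * y) = c ^ p * \<phi> x y)"


subsection \<open>Linear algebra\<close>

definition kron_mat :: "real mat \<Rightarrow> real mat \<Rightarrow> real mat" where
  "kron_mat A B = mat (dim_row A * dim_row B) (dim_col A * dim_col B)
     (\<lambda>(r, c). A $$ (r div dim_row B, c div dim_col B) * B $$ (r mod dim_row B, c mod dim_col B))"

definition kron_vec :: "real vec \<Rightarrow> real vec \<Rightarrow> real vec" where
  "kron_vec u v = vec (dim_vec u * dim_vec v) (\<lambda>k. u $ (k div dim_vec v) * v $ (k mod dim_vec v))"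

text \<open>The operation \<open>vec\<close> that stacks the columns of a matrix, and its inverse.\<close>

definition stack_cols :: "real mat \<Rightarrow> real vec" where
  "stack_cols A = vec (dim_row A * dim_col A) (\<lambda>k. A $$ (k mod dim_row A, k div dim_row A))"

definition unstack_cols :: "nat \<Rightarrow> nat \<Rightarrow> real vec \<Rightarrow> real mat" where
  "unstack_cols nr nc v = mat nr nc (\<lambda>(r, c). v $ (c * nr + r))"

lemma stack_unstack_cols:
  assumes "v \<in> carrier_vec (nr * nc)"
  shows "stack_cols (unstack_cols nr nc v) = v"
proof (rule eq_vecI)
  show "dim_vec (stack_cols (unstack_cols nr nc v)) = dim_vec v"
    using assms by (simp add: stack_cols_def unstack_cols_def)
  fix k assume "k < dim_vec v"
  hence k: "k < nr * nc" using assms by simp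
  hence "nr > 0" by (cases nr) auto
  moreover have "k div nr < nc"
    using k by (simp add: less_mult_imp_div_less mult.commute)
  ultimately show "stack_cols (unstack_cols nr nc v) $ k = v $ k"
    using k by (simp add: stack_cols_def unstack_cols_def)
qed

definition concat_vecs :: "real vec list \<Rightarrow> real vec" where
  "concat_vecs vs = foldr (@\<^sub>v) vs (0\<^sub>v 0)"

definition norm_vec :: "real vec \<Rightarrow> real" where
  "norm_vec v = sqrt (v \<bullet> v)"


subsection \<open>Representations of SO(3), spherical harmonics, Clebsch-Gordan matrices\<close>

definition SO3 :: "(real ^ 3 ^ 3) set" where
  "SO3 = {r. rotation_matrix r}"

definition orthogonal_rep :: "nat \<Rightarrow> (real ^ 3 ^ 3 \<Rightarrow> real mat) \<Rightarrow> bool" where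
  "orthogonal_rep n R \<longleftrightarrow>
     (\<forall>r\<in>SO3. R r \<in> carrier_mat n n \<and> transpose_mat (R r) * R r = 1\<^sub>m n) \<and>
     (\<forall>r\<in>SO3. \<forall>s\<in>SO3. R (r ** s) = R r * R s) \<and>
     (\<forall>j<n. \<forall>k<n. continuous_on SO3 (\<lambda>r. R r $$ (j, k)))"

definition invariant_subspace :: "nat \<Rightarrow> (real ^ 3 ^ 3 \<Rightarrow> real mat) \<Rightarrow> real vec set \<Rightarrow> bool" where
  "invariant_subspace n R S \<longleftrightarrow>
     S \<subseteq> carrier_vec n \<and> 0\<^sub>v n \<in> S \<and> (\<forall>u\<in>S. \<forall>v\<in>S. u + v \<in> S) \<and>
     (\<forall>c. \<forall>v\<in>S. c \<cdot>\<^sub>v v \<in> S) \<and> (\<forall>r\<in>SO3. \<forall>v\<in>S. R r *\<^sub>v v \<in> S)"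

definition irreducible_rep :: "nat \<Rightarrow> (real ^ 3 ^ 3 \<Rightarrow> real mat) \<Rightarrow> bool" where
  "irreducible_rep n R \<longleftrightarrow>
     n > 0 \<and> (\<forall>S. invariant_subspace n R S \<longrightarrow> S = {0\<^sub>v n} \<or> S = carrier_vec n)"

definition SO3_irreps :: "(nat \<Rightarrow> real ^ 3 ^ 3 \<Rightarrow> real mat) \<Rightarrow> bool" where
  "SO3_irreps \<rho> \<longleftrightarrow>
     (\<forall>p. orthogonal_rep (2 * p + 1) (\<rho> p) \<and> irreducible_rep (2 * p + 1) (\<rho> p))"

definition laplacian :: "(real ^ 3 \<Rightarrow> real) \<Rightarrow> real ^ 3 \<Rightarrow> real" where
  "laplacian h x = (\<Sum>e\<in>Basis. deriv (deriv (\<lambda>t. h (x + t *\<^sub>R e))) 0)"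

definition harmonic_polynomial :: "nat \<Rightarrow> (real ^ 3 \<Rightarrow> real) \<Rightarrow> bool" where
  "harmonic_polynomial J h \<longleftrightarrow>
     real_polynomial_function h \<and> (\<forall>c x. h (c *\<^sub>R x) = c ^ J * h x) \<and> (\<forall>x. laplacian h x = 0)"

text \<open>
  The entries of \<open>Y J\<close> are a basis of the degree-\<open>J\<close> spherical harmonics, that is, of the
  restrictions to the unit sphere of homogeneous harmonic polynomials of degree \<open>J\<close>
  (a space of dimension \<open>2J + 1\<close>).  Because \<open>\<rho> J\<close> is orthogonal and irreducible, the
  equivariance makes this basis orthogonal with entries of equal norm; the overall
  normalization factor is left open.  Only the values of \<open>Y J\<close> on the unit sphere matter.
\<close>

definition spherical_harmonics ::
    "(nat \<Rightarrow> real ^ 3 ^ 3 \<Rightarrow> real mat) \<Rightarrow> (nat \<Rightarrow> real ^ 3 \<Rightarrow> real vec) \<Rightarrow> bool" where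
  "spherical_harmonics \<rho> Y \<longleftrightarrow> (\<forall>J.
     (\<forall>x. norm x = 1 \<longrightarrow> Y J x \<in> carrier_vec (2 * J + 1)) \<and>
     (\<forall>m<2 * J + 1. \<exists>h. harmonic_polynomial J h \<and> (\<forall>x. norm x = 1 \<longrightarrow> Y J x $ m = h x)) \<and>
     (\<forall>a. (\<forall>x. norm x = 1 \<longrightarrow> (\<Sum>m<2 * J + 1. a m * Y J x $ m) = 0) \<longrightarrow> (\<forall>m<2 * J + 1. a m = 0)) \<and>
     (\<forall>r\<in>SO3. \<forall>x. norm x = 1 \<longrightarrow> Y J (r *v x) = \<rho> J r *\<^sub>v Y J x))"

text \<open>
  \<open>Y J (x / \<parallel>x\<parallel>)\<close> with the convention for \<open>x = 0\<close>.  \<open>Y 0\<close> is constant on the sphere, so the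
  unit vector \<open>axis 1 1\<close> is an arbitrary choice.
\<close>

definition Y_direction :: "(nat \<Rightarrow> real ^ 3 \<Rightarrow> real vec) \<Rightarrow> nat \<Rightarrow> real ^ 3 \<Rightarrow> real vec" where
  "Y_direction Y J x =
     (if x \<noteq> 0 then Y J (x /\<^sub>R norm x)
      else if J > 0 then 0\<^sub>v (2 * J + 1)
      else Y 0 (axis 1 1))"

definition cg_range :: "nat \<Rightarrow> nat \<Rightarrow> nat set" where
  "cg_range i l = {J. \<bar>int i - int l\<bar> \<le> int J \<and> J \<le> i + l}"

text \<open>
  By Schur's lemma and multiplicity one, the nonzero intertwiners are the usual
  Clebsch-Gordan matrix up to a scalar factor.
\<close>

definition clebsch_gordan ::
    "(nat \<Rightarrow> real ^ 3 ^ 3 \<Rightarrow> real mat) \<Rightarrow> (nat \<Rightarrow> nat \<Rightarrow> nat \<Rightarrow> real mat) \<Rightarrow> bool" where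
  "clebsch_gordan \<rho> C \<longleftrightarrow> (\<forall>i l. \<forall>J\<in>cg_range i l.
     C i l J \<in> carrier_mat ((2 * i + 1) * (2 * l + 1)) (2 * J + 1) \<and>
     C i l J \<noteq> 0\<^sub>m ((2 * i + 1) * (2 * l + 1)) (2 * J + 1) \<and>
     (\<forall>r\<in>SO3. kron_mat (\<rho> i r) (\<rho> l r) * C i l J = C i l J * \<rho> J r))"

text \<open>The coefficient \<open>\<langle>i, m, l, m' | J, m''\<rangle>\<close>.\<close>

definition cg_coeff ::
    "(nat \<Rightarrow> nat \<Rightarrow> nat \<Rightarrow> real mat) \<Rightarrow> nat \<Rightarrow> nat \<Rightarrow> nat \<Rightarrow> nat \<Rightarrow> nat \<Rightarrow> nat \<Rightarrow> real" where
  "cg_coeff C i m l m' J m'' = C i l J $$ (m * (2 * l + 1) + m', m'')"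


subsection \<open>Kernels\<close>

type_synonym degree6 = "nat \<times> nat"

definition fdim :: "degree6 \<Rightarrow> nat" where
  "fdim i = (2 * fst i + 1) * (2 * snd i + 1)"

text \<open>
  Rows \<open>(m1, m2, m3, m4)\<close> and columns \<open>(m5, m6)\<close> are enumerated lexicographically, the last
  index running fastest.  This is the order in which \<^const>\<open>stack_cols\<close> runs through a kernel
  with rows \<open>(m3, m4)\<close> and columns \<open>(m1, m2)\<close>, and \<^const>\<open>kron_vec\<close> through \<open>(m5, m6)\<close>.
\<close>

definition cg2 ::
    "(nat \<Rightarrow> nat \<Rightarrow> nat \<Rightarrow> real mat) \<Rightarrow> degree6 \<Rightarrow> degree6 \<Rightarrow> nat \<Rightarrow> nat \<Rightarrow> real mat" where
  "cg2 C l i J1 J2 = mat (fdim l * fdim i) ((2 * J1 + 1) * (2 * J2 + 1))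
     (\<lambda>(r, c).
       let m1 = r div fdim l div (2 * snd i + 1); m2 = r div fdim l mod (2 * snd i + 1);
           m3 = r mod fdim l div (2 * snd l + 1); m4 = r mod fdim l mod (2 * snd l + 1);
           m5 = c div (2 * J2 + 1); m6 = c mod (2 * J2 + 1)
       in cg_coeff C (fst i) m1 (fst l) m3 J1 m5 * cg_coeff C (snd i) m2 (snd l) m4 J2 m6)"

text \<open>
  Points of \<open>\<real>\<^sup>6\<close> are pairs \<open>(z1, z2)\<close>; the product norm is the Euclidean norm of \<open>\<real>\<^sup>6\<close>.
\<close>

type_synonym point6 = "(real ^ 3) \<times> (real ^ 3)"

definition kernel_vec ::
    "(nat \<Rightarrow> real ^ 3 \<Rightarrow> real vec) \<Rightarrow> (nat \<Rightarrow> nat \<Rightarrow> nat \<Rightarrow> real mat) \<Rightarrow>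
     (nat \<Rightarrow> nat \<Rightarrow> real \<Rightarrow> real \<Rightarrow> real) \<Rightarrow> degree6 \<Rightarrow> degree6 \<Rightarrow> point6 \<Rightarrow> real vec" where
  "kernel_vec Y C \<phi> l i z = finsum_vec TYPE(real) (fdim l * fdim i)
     (\<lambda>(J1, J2). \<phi> J1 J2 (norm (fst z)) (norm (snd z)) \<cdot>\<^sub>v
        (cg2 C l i J1 J2 *\<^sub>v kron_vec (Y_direction Y J1 (fst z)) (Y_direction Y J2 (snd z))))
     (cg_range (fst i) (fst l) \<times> cg_range (snd i) (snd l))"

definition kernel ::
    "(nat \<Rightarrow> real ^ 3 \<Rightarrow> real vec) \<Rightarrow> (nat \<Rightarrow> nat \<Rightarrow> nat \<Rightarrow> real mat) \<Rightarrow>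
     (nat \<Rightarrow> nat \<Rightarrow> real \<Rightarrow> real \<Rightarrow> real) \<Rightarrow> degree6 \<Rightarrow> degree6 \<Rightarrow> point6 \<Rightarrow> real mat" where
  "kernel Y C \<phi> l i z = unstack_cols (fdim l) (fdim i) (kernel_vec Y C \<phi> l i z)"

lemma kernel_vec_carrier: "kernel_vec Y C \<phi> l i z \<in> carrier_vec (fdim l * fdim i)"
  unfolding kernel_vec_def
  by (rule finsum_vec_closed) (auto simp: cg2_def mult_mat_vec_def)

lemma stack_cols_kernel: "stack_cols (kernel Y C \<phi> l i z) = kernel_vec Y C \<phi> l i z"
  unfolding kernel_def by (rule stack_unstack_cols[OF kernel_vec_carrier])


subsection \<open>Tensor fields\<close>

text \<open>
  The degrees are listed without repetition, in the order used for concatenation;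
  the channels of degree \<open>i\<close> are numbered \<open>0, \<dots>, chans \<tau> i - 1\<close>.
\<close>

record field_type =
  degs :: "degree6 list"
  chans :: "degree6 \<Rightarrow> nat"

text \<open>
  The points are \<open>point f u\<close> for \<open>u \<in> {1..npts f}\<close>, and \<open>feat f i b u\<close> is the feature
  \<open>f\<^sup>i\<^sup>,\<^sup>b(z\<^sub>u)\<close>; other arguments carry no meaning.
\<close>

record tensor_field =
  npts :: nat
  point :: "nat \<Rightarrow> point6"
  feat :: "degree6 \<Rightarrow> nat \<Rightarrow> nat \<Rightarrow> real vec"

definition has_type :: "field_type \<Rightarrow> tensor_field \<Rightarrow> bool" where
  "has_type \<tau> f \<longleftrightarrow>
     (\<forall>i\<in>set (degs \<tau>). \<forall>b<chans \<tau> i. \<forall>u\<in>{1..npts f}. feat f i b u \<in> carrier_vec (fdim i))"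

definition same_field :: "field_type \<Rightarrow> tensor_field \<Rightarrow> tensor_field \<Rightarrow> bool" where
  "same_field \<tau> f g \<longleftrightarrow>
     npts f = npts g \<and>
     (\<forall>u\<in>{1..npts f}. point f u = point g u) \<and>
     (\<forall>i\<in>set (degs \<tau>). \<forall>b<chans \<tau> i. \<forall>u\<in>{1..npts f}. feat f i b u = feat g i b u)"

definition feat_mat :: "field_type \<Rightarrow> tensor_field \<Rightarrow> degree6 \<Rightarrow> nat \<Rightarrow> real mat" where
  "feat_mat \<tau> f i u = mat_of_rows (fdim i) (map (\<lambda>b. feat f i b u) [0..<chans \<tau> i])"

text \<open>The field \<open>z \<mapsto> c\<^sup>p f(c\<^sup>-\<^sup>1 z)\<close>.\<close>

definition scale_field :: "nat \<Rightarrow> real \<Rightarrow> tensor_field \<Rightarrow> tensor_field" where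
  "scale_field p c f =
     \<lparr>npts = npts f, point = (\<lambda>u. c *\<^sub>R point f u), feat = (\<lambda>i b u. c ^ p \<cdot>\<^sub>v feat f i b u)\<rparr>"

text \<open>Degree-\<open>p\<close> equivariant input fields yield degree-\<open>q\<close> equivariant output fields.\<close>

definition scale_equivariant ::
    "nat \<Rightarrow> nat \<Rightarrow> field_type \<Rightarrow> field_type \<Rightarrow> (tensor_field \<Rightarrow> tensor_field) \<Rightarrow> bool" where
  "scale_equivariant p q \<tau>in \<tau>out \<L> \<longleftrightarrow>
     (\<forall>f c. has_type \<tau>in f \<longrightarrow> c > 0 \<longrightarrow>
        same_field \<tau>out (\<L> (scale_field p c f)) (scale_field q c (\<L> f)))"


subsection \<open>The transformer layer\<close>

text \<open>
  \<open>W_self T l a\<close> is \<open>W\<^sup>l\<^sup>,\<^sup>a\<close> and \<open>W_query T l\<close> is the query weight of degree \<open>l\<close>.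
  The radial functions of the key kernel with indices \<open>(l, i, b)\<close> are \<open>phi_K T l i b J1 J2\<close>, those
  of the value kernel with indices \<open>(l, i, a, b)\<close> are \<open>phi_V T l i a b J1 J2\<close>.
\<close>

record transformer =
  in_type :: field_type
  out_type :: field_type
  nbrs :: nat
  W_self :: "degree6 \<Rightarrow> nat \<Rightarrow> real vec"
  W_query :: "degree6 \<Rightarrow> real vec"
  phi_K :: "degree6 \<Rightarrow> degree6 \<Rightarrow> nat \<Rightarrow> nat \<Rightarrow> nat \<Rightarrow> real \<Rightarrow> real \<Rightarrow> real"
  phi_V :: "degree6 \<Rightarrow> degree6 \<Rightarrow> nat \<Rightarrow> nat \<Rightarrow> nat \<Rightarrow> nat \<Rightarrow> real \<Rightarrow> real \<Rightarrow> real"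

definition transformer_wf :: "transformer \<Rightarrow> bool" where
  "transformer_wf T \<longleftrightarrow>
     distinct (degs (in_type T)) \<and> distinct (degs (out_type T)) \<and>
     (\<forall>l\<in>set (degs (in_type T)). W_query T l \<in> carrier_vec (chans (in_type T) l)) \<and>
     (\<forall>l\<in>set (degs (in_type T)) \<inter> set (degs (out_type T)). \<forall>a<chans (out_type T) l.
        W_self T l a \<in> carrier_vec (chans (in_type T) l))"

text \<open>\<^const>\<open>sort_key\<close> is stable, so ties are broken by index.\<close>

definition KNN :: "nat \<Rightarrow> tensor_field \<Rightarrow> nat \<Rightarrow> nat set" where
  "KNN k f u = set (take k (sort_key (\<lambda>v. dist (point f u) (point f v)) [1..<Suc (npts f)]))"

definition channel_index :: "field_type \<Rightarrow> (degree6 \<times> nat) set" where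
  "channel_index \<tau> = (SIGMA i:set (degs \<tau>). {..<chans \<tau> i})"

definition row_times :: "real vec \<Rightarrow> real mat \<Rightarrow> real vec" where
  "row_times w F = transpose_mat F *\<^sub>v w"

definition query :: "transformer \<Rightarrow> tensor_field \<Rightarrow> nat \<Rightarrow> real vec" where
  "query T f u = concat_vecs
     (map (\<lambda>l. row_times (W_query T l) (feat_mat (in_type T) f l u)) (degs (in_type T)))"

definition key ::
    "(nat \<Rightarrow> real ^ 3 \<Rightarrow> real vec) \<Rightarrow> (nat \<Rightarrow> nat \<Rightarrow> nat \<Rightarrow> real mat) \<Rightarrow>
     transformer \<Rightarrow> tensor_field \<Rightarrow> nat \<Rightarrow> nat \<Rightarrow> real vec" where
  "key Y C T f u v = concat_vecs
     (map (\<lambda>l. finsum_vec TYPE(real) (fdim l)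
             (\<lambda>(i, b). kernel Y C (phi_K T l i b) l i (point f v - point f u) *\<^sub>v feat f i b v)
             (channel_index (in_type T)))
        (degs (in_type T)))"

definition attention ::
    "(nat \<Rightarrow> real ^ 3 \<Rightarrow> real vec) \<Rightarrow> (nat \<Rightarrow> nat \<Rightarrow> nat \<Rightarrow> real mat) \<Rightarrow>
     transformer \<Rightarrow> tensor_field \<Rightarrow> nat \<Rightarrow> nat \<Rightarrow> real" where
  "attention Y C T f u v =
     exp (query T f u \<bullet> key Y C T f u v) /
     (\<Sum>v'\<in>KNN (nbrs T) f u - {u}. exp (query T f u \<bullet> key Y C T f u v'))"

definition transformer_feat ::
    "(nat \<Rightarrow> real ^ 3 \<Rightarrow> real vec) \<Rightarrow> (nat \<Rightarrow> nat \<Rightarrow> nat \<Rightarrow> real mat) \<Rightarrow>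
     transformer \<Rightarrow> tensor_field \<Rightarrow> degree6 \<Rightarrow> nat \<Rightarrow> nat \<Rightarrow> real vec" where
  "transformer_feat Y C T f l a u =
     (if l \<in> set (degs (in_type T))
      then row_times (W_self T l a) (feat_mat (in_type T) f l u) else 0\<^sub>v (fdim l)) +
     finsum_vec TYPE(real) (fdim l)
       (\<lambda>v. attention Y C T f u v \<cdot>\<^sub>v
          finsum_vec TYPE(real) (fdim l)
            (\<lambda>(i, b). kernel Y C (phi_V T l i a b) l i (point f v - point f u) *\<^sub>v feat f i b v)
            (channel_index (in_type T)))
       (KNN (nbrs T) f u - {u})"

definition transformer_layer ::
    "(nat \<Rightarrow> real ^ 3 \<Rightarrow> real vec) \<Rightarrow> (nat \<Rightarrow> nat \<Rightarrow> nat \<Rightarrow> real mat) \<Rightarrow>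
     transformer \<Rightarrow> tensor_field \<Rightarrow> tensor_field" where
  "transformer_layer Y C T f =
     \<lparr>npts = npts f, point = point f, feat = transformer_feat Y C T f\<rparr>"

definition key_radials_homogeneous :: "nat \<Rightarrow> transformer \<Rightarrow> bool" where
  "key_radials_homogeneous p T \<longleftrightarrow>
     (\<forall>l\<in>set (degs (in_type T)). \<forall>(i, b)\<in>channel_index (in_type T).
        \<forall>J1\<in>cg_range (fst i) (fst l). \<forall>J2\<in>cg_range (snd i) (snd l).
          homogeneous2 p (phi_K T l i b J1 J2))"

definition value_radials_homogeneous :: "nat \<Rightarrow> transformer \<Rightarrow> bool" where
  "value_radials_homogeneous p T \<longleftrightarrow>
     (\<forall>(l, a)\<in>channel_index (out_type T). \<forall>(i, b)\<in>channel_index (in_type T).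
        \<forall>J1\<in>cg_range (fst i) (fst l). \<forall>J2\<in>cg_range (snd i) (snd l).
          homogeneous2 p (phi_V T l i a b J1 J2))"

definition self_weights_zero :: "transformer \<Rightarrow> bool" where
  "self_weights_zero T \<longleftrightarrow>
     (\<forall>(l, a)\<in>channel_index (out_type T). l \<in> set (degs (in_type T)) \<longrightarrow>
        W_self T l a = 0\<^sub>v (chans (in_type T) l))"


subsection \<open>The Elu layer\<close>

definition elu_wf ::
    "field_type \<Rightarrow> (degree6 \<Rightarrow> real mat) \<Rightarrow> (degree6 \<Rightarrow> real mat) \<Rightarrow> bool" where
  "elu_wf \<tau> W\<mu> W\<nu> \<longleftrightarrow> distinct (degs \<tau>) \<and>
     (\<forall>i\<in>set (degs \<tau>). W\<mu> i \<in> carrier_mat (chans \<tau> i) (chans \<tau> i) \<and>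
                        W\<nu> i \<in> carrier_mat (chans \<tau> i) (chans \<tau> i))"

definition elu :: "real vec \<Rightarrow> real vec \<Rightarrow> real vec" where
  "elu \<mu> \<nu> =
     (if \<mu> \<bullet> \<nu> \<ge> 0 then \<mu>
      else \<mu> - (\<mu> \<bullet> ((1 / norm_vec \<nu>) \<cdot>\<^sub>v \<nu>)) \<cdot>\<^sub>v ((1 / norm_vec \<nu>) \<cdot>\<^sub>v \<nu>))"

definition elu_layer ::
    "field_type \<Rightarrow> (degree6 \<Rightarrow> real mat) \<Rightarrow> (degree6 \<Rightarrow> real mat) \<Rightarrow>
     tensor_field \<Rightarrow> tensor_field" where
  "elu_layer \<tau> W\<mu> W\<nu> f =
     \<lparr>npts = npts f, point = point f,
      feat = (\<lambda>i b u. elu (row (W\<mu> i * feat_mat \<tau> f i u) b) (row (W\<nu> i * feat_mat \<tau> f i u) b))\<rparr>"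

end

theory Submission
  imports Defs
begin

text \<open>
  Directions are invariant under dilations, so a kernel inherits the degree of homogeneity of its
  radial functions.  Dilations preserve the order of distances, hence the neighbourhoods; with
  degree-0 features and key kernels the attention weights are invariant as well, and the output
  scales like the value kernels.  The Elu operation commutes with multiplication of both arguments
  by the same positive number.
\<close>

section \<open>Neighbourhoods under dilation\<close>

text \<open>Insertion only compares keys, so the resulting list, including the placement of ties,
  depends on nothing but the preorder that the key induces.\<close>

lemma insort_key_order_embedding:
  fixes g :: "'a \<Rightarrow> 'b::linorder" and h :: "'a \<Rightarrow> 'c::linorder"
  assumes "\<And>x y. h x \<le> h y \<longleftrightarrow> g x \<le> g y"
  shows "insort_key h x xs = insort_key g x xs"
  by (induction xs) (simp_all add: assms)

lemma sort_key_order_embedding: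
  fixes g :: "'a \<Rightarrow> 'b::linorder" and h :: "'a \<Rightarrow> 'c::linorder"
  assumes "\<And>x y. h x \<le> h y \<longleftrightarrow> g x \<le> g y"
  shows "sort_key h xs = sort_key g xs"
  by (induction xs) (simp_all add: insort_key_order_embedding[of h g, OF assms])

lemma KNN_scale:
  assumes "c > 0"
  shows "KNN k (scale_field p c f) u = KNN k f u"
proof -
  have "sort_key (\<lambda>v. dist (c *\<^sub>R point f u) (c *\<^sub>R point f v)) xs
      = sort_key (\<lambda>v. dist (point f u) (point f v)) xs" for xs
    by (rule sort_key_order_embedding) (use assms in \<open>simp add: dist_norm flip: scaleR_diff_right\<close>)
  then show ?thesis
    by (simp add: KNN_def scale_field_def)
qed

text \<open>Since \<open>has_type\<close> speaks only about indices from 1 to \<open>npts f\<close>,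
  neighbours have to be located in this range before it can be applied to them.\<close>

lemma KNN_subset: "KNN k f u \<subseteq> {1..npts f}"
proof -
  have "KNN k f u \<subseteq> set (sort_key (\<lambda>v. dist (point f u) (point f v)) [1..<Suc (npts f)])"
    unfolding KNN_def by (rule set_take_subset)
  then show ?thesis
    by auto
qed

section \<open>Homogeneity of kernels\<close>

text \<open>For \<open>x \<noteq> 0\<close> the factor \<open>c\<close> cancels on normalization;
  for \<open>x = 0\<close> both sides are the same default value.\<close>

lemma Y_direction_scale:
  assumes "c > 0"
  shows "Y_direction Y J (c *\<^sub>R x) = Y_direction Y J x"
  using assms by (simp add: Y_direction_def inverse_mult_distrib field_simps)

text \<open>The summands are compared on \<open>A\<close> only, because the scaling laws for
  messages and attention are available only at actual channels and neighbours.\<close>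

lemma finsum_vec_smult:
  fixes g :: "'b \<Rightarrow> 'a::ring vec"
  assumes "finite A" and "\<And>x. x \<in> A \<Longrightarrow> g x \<in> carrier_vec n"
    and "\<And>x. x \<in> A \<Longrightarrow> h x = k \<cdot>\<^sub>v g x"
  shows "finsum_vec TYPE('a) n h A = k \<cdot>\<^sub>v finsum_vec TYPE('a) n g A"
  using assms
proof (induction A)
  case empty
  then show ?case by (auto simp: finsum_vec_empty)
next
  case (insert x A)
  have carrier: "g \<in> A \<rightarrow> carrier_vec n" "h \<in> A \<rightarrow> carrier_vec n"
    using insert.prems by auto
  moreover have "finsum_vec TYPE('a) n g A \<in> carrier_vec n"
    by (rule finsum_vec_closed[OF carrier(1)])
  ultimately show ?case
    using insert by (simp add: finsum_vec_insert smult_add_distrib_vec[of _ n])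
qed

lemma finite_cg_range [simp]: "finite (cg_range i l)"
  by (rule finite_subset[of _ "{..i + l}"]) (auto simp: cg_range_def)

lemma finite_channel_index [simp]: "finite (channel_index \<tau>)"
  by (auto simp: channel_index_def)

lemma kernel_carrier: "kernel Y C \<phi> l i z \<in> carrier_mat (fdim l) (fdim i)"
  by (simp add: kernel_def unstack_cols_def)

text \<open>In every summand both norms gain the factor \<open>c\<close>, so the radial value gains
  \<open>c ^ p\<close>, while the angular factor does not change.\<close>

lemma kernel_vec_scale:
  assumes "c > 0"
    and "\<And>J1 J2. J1 \<in> cg_range (fst i) (fst l) \<Longrightarrow> J2 \<in> cg_range (snd i) (snd l) \<Longrightarrow>
           homogeneous2 p (\<phi> J1 J2)"
  shows "kernel_vec Y C \<phi> l i (c *\<^sub>R z) = c ^ p \<cdot>\<^sub>v kernel_vec Y C \<phi> l i z"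
  unfolding kernel_vec_def
  by (rule finsum_vec_smult)
     (use assms in \<open>auto simp: Y_direction_scale homogeneous2_def cg2_def smult_smult_assoc
        intro!: smult_carrier_vec carrier_vecI\<close>)

lemma kernel_scale:
  assumes "c > 0"
    and "\<And>J1 J2. J1 \<in> cg_range (fst i) (fst l) \<Longrightarrow> J2 \<in> cg_range (snd i) (snd l) \<Longrightarrow>
           homogeneous2 p (\<phi> J1 J2)"
  shows "kernel Y C \<phi> l i (c *\<^sub>R z) = c ^ p \<cdot>\<^sub>m kernel Y C \<phi> l i z"
proof (rule eq_matI)
  fix r s
  assume "r < dim_row (c ^ p \<cdot>\<^sub>m kernel Y C \<phi> l i z)" "s < dim_col (c ^ p \<cdot>\<^sub>m kernel Y C \<phi> l i z)"
  then have rs: "r < fdim l" "s < fdim i"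
    using kernel_carrier[of Y C \<phi> l i z] by auto
  \<comment> \<open>Entry \<open>(r, s)\<close> is read from position \<open>s * fdim l + r\<close>
    of the stacked vector. A scalar can be pulled out of an entry only at a position inside the
    vector, hence the bound.\<close>
  have "s * fdim l + r < Suc s * fdim l"
    using rs by simp
  also have "\<dots> \<le> fdim i * fdim l"
    using rs by (intro mult_right_mono) auto
  finally have "s * fdim l + r < dim_vec (kernel_vec Y C \<phi> l i z)"
    using kernel_vec_carrier[of Y C \<phi> l i z] by (simp add: mult.commute)
  with rs show "kernel Y C \<phi> l i (c *\<^sub>R z) $$ (r, s) = (c ^ p \<cdot>\<^sub>m kernel Y C \<phi> l i z) $$ (r, s)"
    using kernel_vec_scale[OF assms] by (simp add: kernel_def unstack_cols_def)
qed (simp_all add: kernel_def unstack_cols_def)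

section \<open>Messages, keys and attention weights\<close>

lemma feat_scale_field [simp]: "feat (scale_field p c f) i b u = c ^ p \<cdot>\<^sub>v feat f i b u"
  by (simp add: scale_field_def)

lemma smult_mat_mult_vec:
  fixes A :: "'a::ring mat"
  assumes "A \<in> carrier_mat nr nc" and "v \<in> carrier_vec nc"
  shows "(k \<cdot>\<^sub>m A) *\<^sub>v v = k \<cdot>\<^sub>v (A *\<^sub>v v)"
  using assms by (intro eq_vecI) (auto simp: scalar_prod_def sum_distrib_left mult.assoc)

text \<open>Relative positions are multiplied by \<open>c\<close> and degree-0 features stay fixed,
  so all of \<open>c ^ q\<close> comes from the kernels. The family \<open>\<phi>\<close> is kept
  abstract to serve both the keys (\<open>q = 0\<close>) and the values.\<close>

lemma kernel_message_scale:
  assumes "c > 0" and "has_type \<tau> f" and "v \<in> {1..npts f}"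
    and "\<And>i b J1 J2. (i, b) \<in> channel_index \<tau> \<Longrightarrow> J1 \<in> cg_range (fst i) (fst l) \<Longrightarrow>
           J2 \<in> cg_range (snd i) (snd l) \<Longrightarrow> homogeneous2 q (\<phi> i b J1 J2)"
  shows "finsum_vec TYPE(real) (fdim l)
           (\<lambda>(i, b). kernel Y C (\<phi> i b) l i (point (scale_field 0 c f) v - point (scale_field 0 c f) u)
              *\<^sub>v feat (scale_field 0 c f) i b v) (channel_index \<tau>)
       = c ^ q \<cdot>\<^sub>v finsum_vec TYPE(real) (fdim l)
           (\<lambda>(i, b). kernel Y C (\<phi> i b) l i (point f v - point f u) *\<^sub>v feat f i b v)
           (channel_index \<tau>)"
proof (rule finsum_vec_smult)
  fix ib
  assume ib: "ib \<in> channel_index \<tau>"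
  obtain i b where [simp]: "ib = (i, b)"
    by (cases ib)
  have diff: "point (scale_field 0 c f) v - point (scale_field 0 c f) u = c *\<^sub>R (point f v - point f u)"
    by (simp add: scale_field_def scaleR_diff_right)
  have "feat f i b v \<in> carrier_vec (fdim i)"
    using assms(2,3) ib by (auto simp: has_type_def channel_index_def)
  moreover have "kernel Y C (\<phi> i b) l i (c *\<^sub>R (point f v - point f u))
      = c ^ q \<cdot>\<^sub>m kernel Y C (\<phi> i b) l i (point f v - point f u)"
    using ib assms(1,4) by (intro kernel_scale) auto
  ultimately show "(case ib of (i, b) \<Rightarrow> kernel Y C (\<phi> i b) l i
        (point (scale_field 0 c f) v - point (scale_field 0 c f) u) *\<^sub>v feat (scale_field 0 c f) i b v)
      = c ^ q \<cdot>\<^sub>v (case ib of (i, b) \<Rightarrow>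
          kernel Y C (\<phi> i b) l i (point f v - point f u) *\<^sub>v feat f i b v)"
    unfolding diff
    by (auto simp: smult_mat_mult_vec[OF kernel_carrier])
qed (auto intro!: mult_mat_vec_carrier carrier_vecI simp: kernel_def unstack_cols_def)

lemma feat_mat_scale_0: "feat_mat \<tau> (scale_field 0 c f) i u = feat_mat \<tau> f i u"
  by (simp add: feat_mat_def)

lemma key_scale:
  assumes "c > 0" and "has_type (in_type T) f" and "v \<in> {1..npts f}"
    and "key_radials_homogeneous 0 T"
  shows "key Y C T (scale_field 0 c f) u v = key Y C T f u v"
  unfolding key_def
proof (intro arg_cong[of _ _ concat_vecs] map_cong refl)
  fix l assume l: "l \<in> set (degs (in_type T))"
  show "finsum_vec TYPE(real) (fdim l)
      (\<lambda>(i, b). kernel Y C (phi_K T l i b) l i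
          (point (scale_field 0 c f) v - point (scale_field 0 c f) u) *\<^sub>v feat (scale_field 0 c f) i b v)
      (channel_index (in_type T))
    = finsum_vec TYPE(real) (fdim l)
      (\<lambda>(i, b). kernel Y C (phi_K T l i b) l i (point f v - point f u) *\<^sub>v feat f i b v)
      (channel_index (in_type T))"
    using kernel_message_scale[of c "in_type T" f v l 0 "phi_K T l" Y C u] assms l
    by (fastforce simp: key_radials_homogeneous_def)
qed

text \<open>Queries depend on features alone, keys are invariant by \<open>key_scale\<close>, and
  the index set of the normalizing sum is invariant by \<open>KNN_scale\<close>.\<close>

lemma attention_scale:
  assumes "c > 0" and "has_type (in_type T) f" and "v \<in> KNN (nbrs T) f u"
    and "key_radials_homogeneous 0 T"
  shows "attention Y C T (scale_field 0 c f) u v = attention Y C T f u v"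
proof -
  \<comment> \<open>Needed at every neighbour, not just at \<open>v\<close>, because of the sum in
    the denominator.\<close>
  have key: "key Y C T (scale_field 0 c f) u v' = key Y C T f u v'" if "v' \<in> KNN (nbrs T) f u" for v'
    using key_scale assms that KNN_subset by blast
  have "query T (scale_field 0 c f) u = query T f u"
    by (simp add: query_def feat_mat_scale_0)
  then show ?thesis
    using assms(3) by (simp add: attention_def KNN_scale[OF assms(1)] key)
qed

section \<open>Output of the transformer layer\<close>

lemma row_times_zero:
  "row_times (0\<^sub>v (chans \<tau> i)) (feat_mat \<tau> f i u) = 0\<^sub>v (fdim i)"
  by (intro eq_vecI) (auto simp: row_times_def feat_mat_def scalar_prod_def)

text \<open>The output splits into a self-interaction term, which a dilation leaves fixed, and a
  weighted sum of messages, each of which gains \<open>c ^ q\<close>. The fixed term is compatible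
  with degree \<open>q\<close> because either \<open>q = 0\<close> or it vanishes.\<close>

lemma transformer_feat_scale:
  assumes "c > 0" and "has_type (in_type T) f"
    and "key_radials_homogeneous 0 T" and "value_radials_homogeneous q T"
    and "q = 0 \<or> self_weights_zero T" and la: "(l, a) \<in> channel_index (out_type T)"
  shows "transformer_feat Y C T (scale_field 0 c f) l a u = c ^ q \<cdot>\<^sub>v transformer_feat Y C T f l a u"
proof -
  define self where "self = (if l \<in> set (degs (in_type T))
      then row_times (W_self T l a) (feat_mat (in_type T) f l u) else 0\<^sub>v (fdim l))"
  define msg where "msg g v = finsum_vec TYPE(real) (fdim l)
      (\<lambda>(i, b). kernel Y C (phi_V T l i a b) l i (point g v - point g u) *\<^sub>v feat g i b v)
      (channel_index (in_type T))" for g :: tensor_field and v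
  define nb where "nb = KNN (nbrs T) f u - {u}"
  have self: "self \<in> carrier_vec (fdim l)"
    by (auto simp: self_def row_times_def feat_mat_def intro!: carrier_vecI)
  have msg: "msg g v \<in> carrier_vec (fdim l)" for g v
    unfolding msg_def
    by (rule finsum_vec_closed) (auto intro!: carrier_vecI simp: kernel_def unstack_cols_def)
  have self_scale: "self = c ^ q \<cdot>\<^sub>v self"
  proof (cases "q = 0")
    case False
    \<comment> \<open>Either the weights of degree \<open>l\<close> are zero or the input has no
      such degree; both give the zero vector of length \<open>fdim l\<close>.\<close>
    then have "self = 0\<^sub>v (fdim l)"
      using assms(5) la by (auto simp: self_def self_weights_zero_def row_times_zero)
    then show ?thesis
      by auto
  qed simp
  have msg_scale: "msg (scale_field 0 c f) v = c ^ q \<cdot>\<^sub>v msg f v" if "v \<in> nb" for v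
    unfolding msg_def
  proof (rule kernel_message_scale[OF assms(1,2)])
    show "v \<in> {1..npts f}"
      using that KNN_subset nb_def by blast
  qed (use assms(4) la in \<open>fastforce simp: value_radials_homogeneous_def\<close>)
  have "finsum_vec TYPE(real) (fdim l)
        (\<lambda>v. attention Y C T (scale_field 0 c f) u v \<cdot>\<^sub>v msg (scale_field 0 c f) v) nb
      = c ^ q \<cdot>\<^sub>v finsum_vec TYPE(real) (fdim l) (\<lambda>v. attention Y C T f u v \<cdot>\<^sub>v msg f v) nb"
  proof (rule finsum_vec_smult)
    show "finite nb"
      by (simp add: nb_def KNN_def)
    fix v assume v: "v \<in> nb"
    show "attention Y C T f u v \<cdot>\<^sub>v msg f v \<in> carrier_vec (fdim l)"
      using msg by simp
    have "attention Y C T (scale_field 0 c f) u v = attention Y C T f u v"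
      using v assms(1-3) by (intro attention_scale) (auto simp: nb_def)
    then show "attention Y C T (scale_field 0 c f) u v \<cdot>\<^sub>v msg (scale_field 0 c f) v
        = c ^ q \<cdot>\<^sub>v (attention Y C T f u v \<cdot>\<^sub>v msg f v)"
      by (simp add: msg_scale[OF v] smult_smult_assoc mult.commute)
  qed
  moreover have "finsum_vec TYPE(real) (fdim l) (\<lambda>v. attention Y C T f u v \<cdot>\<^sub>v msg f v) nb
      \<in> carrier_vec (fdim l)"
    by (rule finsum_vec_closed) (use msg in auto)
  moreover have "transformer_feat Y C T f l a u
      = self + finsum_vec TYPE(real) (fdim l) (\<lambda>v. attention Y C T f u v \<cdot>\<^sub>v msg f v) nb"
    unfolding transformer_feat_def self_def msg_def nb_def ..
  \<comment> \<open>Neighbourhood and feature matrix of the dilated field agree with those of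
    \<open>f\<close>, so the same \<open>self\<close> and \<open>nb\<close> occur again.\<close>
  moreover have "transformer_feat Y C T (scale_field 0 c f) l a u
      = self + finsum_vec TYPE(real) (fdim l)
          (\<lambda>v. attention Y C T (scale_field 0 c f) u v \<cdot>\<^sub>v msg (scale_field 0 c f) v) nb"
    unfolding transformer_feat_def self_def msg_def nb_def
      KNN_scale[OF assms(1)] feat_mat_scale_0 ..
  ultimately show ?thesis
    using self by (simp add: smult_add_distrib_vec[of _ "fdim l"] flip: self_scale)
qed

lemma transformer_layer_scale_equivariant:
  assumes "key_radials_homogeneous 0 T" and "value_radials_homogeneous q T"
    and "q = 0 \<or> self_weights_zero T"
  shows "scale_equivariant 0 q (in_type T) (out_type T) (transformer_layer Y C T)"
proof -
  have "transformer_feat Y C T (scale_field 0 c f) l a u = c ^ q \<cdot>\<^sub>v transformer_feat Y C T f l a u"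
    if "has_type (in_type T) f" "c > 0" "l \<in> set (degs (out_type T))" "a < chans (out_type T) l"
    for f c l a u
    using that assms by (intro transformer_feat_scale) (auto simp: channel_index_def)
  then show ?thesis
    by (auto simp: scale_equivariant_def same_field_def transformer_layer_def)
       (auto simp: scale_field_def)
qed

section \<open>The Elu layer\<close>

lemma norm_vec_smult:
  assumes "k \<ge> 0"
  shows "norm_vec (k \<cdot>\<^sub>v v) = k * norm_vec v"
  using assms by (simp add: norm_vec_def real_sqrt_mult flip: mult.assoc)

lemma elu_smult:
  assumes "k > 0" and "\<mu> \<in> carrier_vec n" and "\<nu> \<in> carrier_vec n"
  shows "elu (k \<cdot>\<^sub>v \<mu>) (k \<cdot>\<^sub>v \<nu>) = k \<cdot>\<^sub>v elu \<mu> \<nu>"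
proof -
  \<comment> \<open>This includes \<open>norm_vec \<nu> = 0\<close>, where both quotients are 0 by
    the convention for division.\<close>
  have "(1 / norm_vec (k \<cdot>\<^sub>v \<nu>)) \<cdot>\<^sub>v (k \<cdot>\<^sub>v \<nu>) = (1 / norm_vec \<nu>) \<cdot>\<^sub>v \<nu>"
    using assms(1) by (simp add: norm_vec_smult smult_smult_assoc)
  \<comment> \<open>The inner product gains the positive factor \<open>k * k\<close>, so the same
    branch is taken.\<close>
  moreover have "(k \<cdot>\<^sub>v \<mu>) \<bullet> (k \<cdot>\<^sub>v \<nu>) \<ge> 0 \<longleftrightarrow> \<mu> \<bullet> \<nu> \<ge> 0"
    using assms by (simp add: zero_le_mult_iff)
  \<comment> \<open>To be read with \<open>s\<close> the inner product of \<open>\<mu>\<close> and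
    \<open>\<nu>\<close>, \<open>t = norm_vec \<nu>\<close> and \<open>w\<close> the normalized
    \<open>\<nu>\<close>: the projection is linear in its first argument.\<close>
  moreover have "k \<cdot>\<^sub>v \<mu> - (k * s / t) \<cdot>\<^sub>v w = k \<cdot>\<^sub>v (\<mu> - (s / t) \<cdot>\<^sub>v w)"
    if "w \<in> carrier_vec n" for s t w
    using that assms(2) by (intro eq_vecI) (auto simp: right_diff_distrib)
  ultimately show ?thesis
    using assms by (simp add: elu_def)
qed

lemma feat_mat_scale:
  assumes "has_type \<tau> f" and "i \<in> set (degs \<tau>)" and "u \<in> {1..npts f}"
  shows "feat_mat \<tau> (scale_field p c f) i u = c ^ p \<cdot>\<^sub>m feat_mat \<tau> f i u"
proof (rule eq_matI)
  fix b m
  assume "b < dim_row (c ^ p \<cdot>\<^sub>m feat_mat \<tau> f i u)" "m < dim_col (c ^ p \<cdot>\<^sub>m feat_mat \<tau> f i u)"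
  then have bm: "b < chans \<tau> i" "m < fdim i"
    by (auto simp: feat_mat_def)
  \<comment> \<open>The length of the feature puts column \<open>m\<close> inside the vector, so
    that \<open>c ^ p\<close> can be pulled out of the entry.\<close>
  then have "dim_vec (feat f i b u) = fdim i"
    using assms by (auto simp: has_type_def)
  with bm show "feat_mat \<tau> (scale_field p c f) i u $$ (b, m) = (c ^ p \<cdot>\<^sub>m feat_mat \<tau> f i u) $$ (b, m)"
    by (simp add: feat_mat_def mat_of_rows_def)
qed (simp_all add: feat_mat_def)

lemma row_mult_smult:
  fixes A :: "'a::comm_semiring_0 mat"
  assumes "A \<in> carrier_mat nr n" and "B \<in> carrier_mat n nc" and "b < nr"
  shows "row (A * (k \<cdot>\<^sub>m B)) b = k \<cdot>\<^sub>v row (A * B) b"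
  using assms by (intro eq_vecI) (auto simp: mult_smult_distrib)

text \<open>The weight matrices mix channels from the left, so the factor \<open>c ^ p\<close>
  passes through them and reaches both arguments of \<open>elu\<close>, where
  \<open>elu_smult\<close> applies.\<close>

lemma elu_layer_scale_equivariant:
  assumes "elu_wf \<tau> W\<mu> W\<nu>"
  shows "scale_equivariant p p \<tau> \<tau> (elu_layer \<tau> W\<mu> W\<nu>)"
proof -
  have "elu (row (W\<mu> i * feat_mat \<tau> (scale_field p c f) i u) b)
            (row (W\<nu> i * feat_mat \<tau> (scale_field p c f) i u) b)
      = c ^ p \<cdot>\<^sub>v elu (row (W\<mu> i * feat_mat \<tau> f i u) b) (row (W\<nu> i * feat_mat \<tau> f i u) b)"
    if "has_type \<tau> f" "c > 0" "i \<in> set (degs \<tau>)" "b < chans \<tau> i" "u \<in> {1..npts f}" for f c i b u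
  proof -
    have W: "W\<mu> i \<in> carrier_mat (chans \<tau> i) (chans \<tau> i)" "W\<nu> i \<in> carrier_mat (chans \<tau> i) (chans \<tau> i)"
      using assms that(3) by (auto simp: elu_wf_def)
    have F: "feat_mat \<tau> f i u \<in> carrier_mat (chans \<tau> i) (fdim i)"
      by (auto simp: feat_mat_def)
    have "elu (c ^ p \<cdot>\<^sub>v row (W\<mu> i * feat_mat \<tau> f i u) b) (c ^ p \<cdot>\<^sub>v row (W\<nu> i * feat_mat \<tau> f i u) b)
      = c ^ p \<cdot>\<^sub>v elu (row (W\<mu> i * feat_mat \<tau> f i u) b) (row (W\<nu> i * feat_mat \<tau> f i u) b)"
      by (rule elu_smult[of _ _ "fdim i"]) (use that(2) W F in \<open>auto intro!: carrier_vecI\<close>)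
    then show ?thesis
      using that by (simp add: feat_mat_scale row_mult_smult[OF W(1) F] row_mult_smult[OF W(2) F])
  qed
  then show ?thesis
    by (auto simp: scale_equivariant_def same_field_def elu_layer_def)
       (auto simp: scale_field_def)
qed

theorem proposition5p5:
  fixes \<rho> :: "nat \<Rightarrow> real ^ 3 ^ 3 \<Rightarrow> real mat"
    and Y :: "nat \<Rightarrow> real ^ 3 \<Rightarrow> real vec"
    and C :: "nat \<Rightarrow> nat \<Rightarrow> nat \<Rightarrow> real mat"
  assumes "SO3_irreps \<rho>"
    and "spherical_harmonics \<rho> Y"
    and "clebsch_gordan \<rho> C"
  shows "(\<forall>T. transformer_wf T \<longrightarrow> key_radials_homogeneous 0 T \<longrightarrow>
            (value_radials_homogeneous 1 T \<and> self_weights_zero T \<longrightarrow>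
               scale_equivariant 0 1 (in_type T) (out_type T) (transformer_layer Y C T)) \<and>
            (value_radials_homogeneous 0 T \<longrightarrow>
               scale_equivariant 0 0 (in_type T) (out_type T) (transformer_layer Y C T))) \<and>
         (\<forall>\<tau> W\<mu> W\<nu> p. elu_wf \<tau> W\<mu> W\<nu> \<longrightarrow>
            scale_equivariant p p \<tau> \<tau> (elu_layer \<tau> W\<mu> W\<nu>))"
  \<comment> \<open>The two transformer claims are the instances \<open>q = 1\<close> and
    \<open>q = 0\<close> of one lemma.\<close>
  by (simp add: transformer_layer_scale_equivariant elu_layer_scale_equivariant)

end
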